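(* Let $a<b$ be real numbers, and let $f:[a, b] \to \mathbb{R}$ be continuous on $[a, b]$ and specularly differentiable on $(a, b)$. Then: (a) $f^{\mathrm{sd}}(x) \geq 0$ (resp. $f^{\mathrm{sd}}(x) \leq 0$) for all $x \in (a, b)$ if and only if $f$ is nondecreasing (resp. nonincreasing) on $[a, b]$. (b) $f^{\mathrm{sd}}(x) = 0$ for all $x \in (a, b)$ if and only if $f$ is constant on $[a, b]$.
   Context: For a real-valued function $f$ defined on a neighborhood of $x\in\mathbb{R}$, the specular derivative of $f$ at $x$ is $$f^{\mathrm{sd}}(x) := \lim_{h \searrow 0} \mathcal{A}(f(x + h) - f(x), f(x) - f(x - h), h)$$ (with $h>0$ small enough that $x\pm h$ lie in the domain), where $\mathcal{A}:\mathbb{R}\times\mathbb{R}\times(0,\infty)\to\mathbb{R}$ is $$\mathcal{A}(a, b, c) := \frac{a \sqrt{b^2 + c^2} + b \sqrt{a^2 + c^2}}{c \sqrt{a^2 + c^2} + c \sqrt{b^2 + c^2}}.$$ $f$ is specularly differentiable at $x$ if this limit exists as a finite real number, and specularly differentiable on an open interval if it is so at every point of that interval. *)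

theory Defs
  imports "HOL-Analysis.Analysis"
begin

definition specular_A :: "real \<Rightarrow> real \<Rightarrow> real \<Rightarrow> real" where
  "specular_A a b c =
     (a * sqrt (b\<^sup>2 + c\<^sup>2) + b * sqrt (a\<^sup>2 + c\<^sup>2)) /
     (c * sqrt (a\<^sup>2 + c\<^sup>2) + c * sqrt (b\<^sup>2 + c\<^sup>2))"

(* Functions are total on the reals.  The limit as h decreases to 0 only involves the values of f
   on arbitrarily small neighbourhoods of x, so for x in the interior of the intended domain of f
   the (arbitrary) values outside that domain play no role. *)
definition has_specular_derivative :: "(real \<Rightarrow> real) \<Rightarrow> real \<Rightarrow> real \<Rightarrow> bool" where
  "has_specular_derivative f D x \<longleftrightarrow>
     ((\<lambda>h. specular_A (f (x + h) - f x) (f x - f (x - h)) h) \<longlongrightarrow> D) (at_right 0)"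

definition specularly_differentiable :: "(real \<Rightarrow> real) \<Rightarrow> real \<Rightarrow> bool" where
  "specularly_differentiable f x \<longleftrightarrow> (\<exists>D. has_specular_derivative f D x)"

definition specularly_differentiable_on :: "(real \<Rightarrow> real) \<Rightarrow> real set \<Rightarrow> bool" where
  "specularly_differentiable_on f S \<longleftrightarrow> (\<forall>x\<in>S. specularly_differentiable f x)"

(* Meaningful only where f is specularly differentiable; unspecified otherwise. *)
definition specular_deriv :: "(real \<Rightarrow> real) \<Rightarrow> real \<Rightarrow> real" where
  "specular_deriv f x =
     Lim (at_right 0) (\<lambda>h. specular_A (f (x + h) - f x) (f x - f (x - h)) h)"

lemma has_specular_derivative_imp_deriv:
  "has_specular_derivative f D x \<Longrightarrow> specular_deriv f x = D"
  unfolding has_specular_derivative_def specular_deriv_def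
  by (intro tendsto_Lim) simp_all

end

theory Submission
  imports Defs
begin

text \<open>
  The specular mean \<^term>\<open>specular_A a b c\<close> is a convex combination of the two one-sided
  difference quotients \<open>a / c\<close> and \<open>b / c\<close>.  Hence every bound, upper or lower,
  that both quotients satisfy holds for it too, and this already settles
  the implication from monotonicity to the sign of the derivative.

  For the other implication, adding a small linear term to \<open>f\<close> in order to make the sign of the
  derivative strict fails, since the specular derivative is not additive.  Instead, a
  quasi-mean value theorem is proved in which the slope is built in from the start: if the chord
  of \<open>f\<close> over \<open>[p, q]\<close> has slope less than \<open>s\<close>, then some interior point has specular
  derivative at most \<open>s\<close> (\<open>quasi_mean_value_upper\<close>).  To find this point, tilt the function to
  \<open>g x = f x - s * x\<close>, so that \<open>g q < g p\<close>, and take the last point \<open>c\<close> at which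
  \<open>g\<close> has a level \<open>k\<close> between \<open>g q\<close> and \<open>g p\<close>.  To the right of \<open>c\<close> the function is below
  \<open>k\<close>, so every right difference quotient of \<open>f\<close> at \<open>c\<close> is below \<open>s\<close>.  The left difference
  quotients are at most \<open>s\<close> for arbitrarily small steps, unless \<open>c\<close> is a strict local maximum
  of \<open>g\<close>.  A function has only countably many strict local maximum values, so a suitable level
  \<open>k\<close> avoids them (\<open>last_crossing_not_strict_max\<close>).  Since the limit defining the specular
  derivative exists, a bound along arbitrarily small steps passes to the limit.

  If \<open>f\<close> decreases somewhere, some chord has negative slope; a negative number \<open>s\<close>
  above that slope then yields a point with derivative at most \<open>s < 0\<close>.  The nonincreasing case
  follows by passing to \<open>- f\<close>, and the constant case is the conjunction of both.
\<close>

lemma specular_A_uminus: "specular_A (- a) (- b) c = - specular_A a b c"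
  by (simp add: specular_A_def minus_divide_left)

text \<open>The bound is inherited from \<open>a / c\<close> and \<open>b / c\<close>, which are averaged with the
  weights \<open>sqrt (b\<^sup>2 + c\<^sup>2)\<close> and \<open>sqrt (a\<^sup>2 + c\<^sup>2)\<close>.\<close>

lemma specular_A_le:
  assumes "c > 0" "a \<le> s * c" "b \<le> s * c"
  shows "specular_A a b c \<le> s"
proof -
  define u where "u = sqrt (a\<^sup>2 + c\<^sup>2)"
  define v where "v = sqrt (b\<^sup>2 + c\<^sup>2)"
  have pos: "u > 0" "v > 0"
    using \<open>c > 0\<close> by (simp_all add: u_def v_def add_nonneg_pos)
  have "a * v + b * u \<le> (s * c) * v + (s * c) * u"
    using assms pos by (intro add_mono mult_right_mono) auto
  also have "\<dots> = s * (c * u + c * v)"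
    by (simp add: algebra_simps)
  finally have "(a * v + b * u) / (c * u + c * v) \<le> s"
    using pos \<open>c > 0\<close> by (subst pos_divide_le_eq) (auto intro: add_pos_pos)
  then show ?thesis
    by (simp add: specular_A_def u_def v_def)
qed

lemma specular_A_nonneg:
  assumes "c > 0" "a \<ge> 0" "b \<ge> 0"
  shows "specular_A a b c \<ge> 0"
  using assms by (simp add: specular_A_def)

lemma has_specular_derivative_specular_deriv:
  "specularly_differentiable f x \<Longrightarrow> has_specular_derivative f (specular_deriv f x) x"
  using has_specular_derivative_imp_deriv by (auto simp: specularly_differentiable_def)

lemma has_specular_derivative_uminus:
  assumes "has_specular_derivative f D x"
  shows "has_specular_derivative (\<lambda>x. - f x) (- D) x"
proof -
  have "specular_A (- f (x + h) - - f x) (- f x - - f (x - h)) h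
      = - specular_A (f (x + h) - f x) (f x - f (x - h)) h" for h
    by (simp flip: specular_A_uminus)
  then show ?thesis
    using assms unfolding has_specular_derivative_def by (simp add: tendsto_minus)
qed

lemma specular_deriv_uminus:
  "specularly_differentiable f x \<Longrightarrow> specular_deriv (\<lambda>x. - f x) x = - specular_deriv f x"
  by (intro has_specular_derivative_imp_deriv has_specular_derivative_uminus
      has_specular_derivative_specular_deriv)

lemma specularly_differentiable_on_uminus:
  "specularly_differentiable_on f S \<Longrightarrow> specularly_differentiable_on (\<lambda>x. - f x) S"
  using has_specular_derivative_uminus
  unfolding specularly_differentiable_on_def specularly_differentiable_def by blast

text \<open>The last crossing of every level exists by compactness.  If it were a strict maximum from the
  left as well, the level would be the supremum of \<open>g\<close> over \<open>{r<..q}\<close> for a rational \<open>r\<close>.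
  That leaves only countably many such levels in the interval \<open>{g q<..<g p}\<close>.\<close>

lemma last_crossing_not_strict_max:
  fixes g :: "real \<Rightarrow> real"
  assumes "p \<le> q" and cont: "continuous_on {p..q} g" and less: "g q < g p"
  obtains c where "c \<in> {p<..<q}" "\<And>x. c < x \<Longrightarrow> x \<le> q \<Longrightarrow> g x < g c"
    "\<exists>\<^sub>F h in at_right 0. g c \<le> g (c - h)"
proof (rule ccontr)
  note crossing = that
  assume contra: "\<not> thesis"
  have "k \<in> (\<lambda>r. Sup (g ` {r<..q})) ` \<rat>" if k: "k \<in> {g q<..<g p}" for k
  proof -
    define S where "S = {p..q} \<inter> g -` {k..}"
    have "closed S"
      unfolding S_def using cont by (intro continuous_closed_preimage) auto
    then have "compact S"
      using bounded_subset[OF bounded_closed_interval, of S p q]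
      by (simp add: compact_eq_bounded_closed S_def)
    moreover have "p \<in> S"
      using \<open>p \<le> q\<close> k by (simp add: S_def)
    ultimately obtain c where "c \<in> S" and c_max: "\<And>x. x \<in> S \<Longrightarrow> x \<le> c"
      using compact_attains_sup[of S] by blast
    then have c: "p \<le> c" "c \<le> q" "k \<le> g c"
      by (auto simp: S_def)
    have below: "g x < k" if "c < x" "x \<le> q" for x
      using c_max[of x] that c by (force simp: S_def)
    have "g c = k"
    proof -
      have "\<exists>x\<ge>c. x \<le> q \<and> g x = k"
        using c k by (intro IVT2' continuous_on_subset[OF cont]) auto
      then show ?thesis
        using below by (metis less_irrefl order_le_less)
    qed
    with c k have c_in: "c \<in> {p<..<q}"
      by (auto simp: less_le)
    have "\<not> (\<exists>\<^sub>F h in at_right 0. g c \<le> g (c - h))"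
      using contra crossing[OF c_in] below unfolding \<open>g c = k\<close> by blast
    then have "\<forall>\<^sub>F h in at_right 0. g (c - h) < g c"
      by (simp add: frequently_def not_le)
    then obtain d where "d > 0" and d: "\<And>h. 0 < h \<Longrightarrow> h < d \<Longrightarrow> g (c - h) < g c"
      by (auto simp: eventually_at_right_field)
    obtain r where r: "r \<in> \<rat>" "c - d < r" "r < c"
      using Rats_dense_in_real[of "c - d" c] \<open>d > 0\<close> by auto
    have "g x \<le> k" if "x \<in> {r<..q}" for x
      using that below[of x] d[of "c - x"] \<open>g c = k\<close> r by (cases c x rule: linorder_cases) auto
    then have "Sup (g ` {r<..q}) = k"
      using r c \<open>g c = k\<close> by (intro cSup_eq_maximum) auto
    with r show ?thesis
      by blast
  qed
  then have "countable {g q<..<g p}"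
    by (meson countable_image countable_rat countable_subset subsetI)
  with less show False
    using uncountable_open_interval[of "g q" "g p"] by simp
qed

text \<open>The point in question is the crossing point supplied for the tilted function
  \<open>g x = f x - s * x\<close>: there both difference quotients are at most \<open>s\<close> along arbitrarily small
  steps, and their specular mean inherits the bound.\<close>

lemma quasi_mean_value_upper:
  fixes f :: "real \<Rightarrow> real"
  assumes "p < q" and cont: "continuous_on {p..q} f"
    and diff: "specularly_differentiable_on f {p<..<q}"
    and slope: "f q - f p < s * (q - p)"
  obtains c where "c \<in> {p<..<q}" "specular_deriv f c \<le> s"
proof -
  define g where "g = (\<lambda>x. f x - s * x)"
  have "continuous_on {p..q} g" "g q < g p"
    using cont slope by (auto simp: g_def algebra_simps intro!: continuous_intros)
  then obtain c where c: "c \<in> {p<..<q}"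
    and right: "\<And>x. c < x \<Longrightarrow> x \<le> q \<Longrightarrow> g x < g c"
    and left: "\<exists>\<^sub>F h in at_right 0. g c \<le> g (c - h)"
    using last_crossing_not_strict_max[of p q g] \<open>p < q\<close> by auto
  let ?A = "\<lambda>h. specular_A (f (c + h) - f c) (f c - f (c - h)) h"
  have "\<forall>\<^sub>F h in at_right 0. h \<in> {0<..<q - c}"
    using c by (intro eventually_at_right_real) auto
  then have "\<forall>\<^sub>F h in at_right 0. g c \<le> g (c - h) \<longrightarrow> ?A h \<le> s"
  proof eventually_elim
    case (elim h)
    show ?case
    proof
      assume "g c \<le> g (c - h)"
      with elim right[of "c + h"] show "?A h \<le> s"
        by (intro specular_A_le) (auto simp: g_def algebra_simps)
    qed
  qed
  with left have freq: "\<exists>\<^sub>F h in at_right 0. ?A h \<le> s"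
    by (rule frequently_rev_mp)
  have lim: "(?A \<longlongrightarrow> specular_deriv f c) (at_right 0)"
    using diff c has_specular_derivative_specular_deriv
    by (auto simp: specularly_differentiable_on_def has_specular_derivative_def)
  have "specular_deriv f c \<le> s"
  proof (rule ccontr)
    assume "\<not> ?thesis"
    then have "\<forall>\<^sub>F h in at_right 0. s < ?A h"
      by (intro order_tendstoD(1)[OF lim]) simp
    with freq show False
      by (simp add: frequently_def not_le)
  qed
  with c show thesis
    by (rule that)
qed

lemma mono_on_imp_specular_deriv_nonneg:
  fixes f :: "real \<Rightarrow> real"
  assumes mono: "mono_on {a..b} f" and x: "x \<in> {a<..<b}"
    and diff: "specularly_differentiable f x"
  shows "specular_deriv f x \<ge> 0"
proof (rule tendsto_lowerbound)
  show "((\<lambda>h. specular_A (f (x + h) - f x) (f x - f (x - h)) h) \<longlongrightarrow> specular_deriv f x)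
      (at_right 0)"
    using has_specular_derivative_specular_deriv[OF diff]
    by (simp add: has_specular_derivative_def)
  have "\<forall>\<^sub>F h in at_right 0. h \<in> {0<..<min (x - a) (b - x)}"
    using x by (intro eventually_at_right_real) auto
  then show "\<forall>\<^sub>F h in at_right 0. 0 \<le> specular_A (f (x + h) - f x) (f x - f (x - h)) h"
  proof eventually_elim
    case (elim h)
    then have "f (x - h) \<le> f x" "f x \<le> f (x + h)"
      by (auto intro!: mono_onD[OF mono])
    with elim show ?case
      by (intro specular_A_nonneg) auto
  qed
qed simp

lemma specular_deriv_nonneg_imp_mono_on:
  fixes f :: "real \<Rightarrow> real"
  assumes cont: "continuous_on {a..b} f"
    and diff: "specularly_differentiable_on f {a<..<b}"
    and nonneg: "\<And>x. x \<in> {a<..<b} \<Longrightarrow> specular_deriv f x \<ge> 0"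
  shows "mono_on {a..b} f"
proof (rule mono_onI, rule ccontr)
  fix p q
  assume pq: "p \<in> {a..b}" "q \<in> {a..b}" "p \<le> q" and "\<not> f p \<le> f q"
  then have "p < q" "f q < f p"
    by (auto simp: less_le)
  then have "(f q - f p) / (q - p) < 0"
    by (simp add: divide_neg_pos)
  then obtain s where "(f q - f p) / (q - p) < s" "s < 0"
    using dense by blast
  with \<open>p < q\<close> have "f q - f p < s * (q - p)"
    by (simp add: pos_divide_less_eq)
  have "continuous_on {p..q} f" "specularly_differentiable_on f {p<..<q}"
    using cont diff pq
    by (auto intro: continuous_on_subset simp: specularly_differentiable_on_def)
  then obtain c where "c \<in> {p<..<q}" "specular_deriv f c \<le> s"
    using quasi_mean_value_upper \<open>p < q\<close> \<open>f q - f p < s * (q - p)\<close> by blast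
  with nonneg[of c] \<open>s < 0\<close> pq show False
    by auto
qed

lemma specular_deriv_nonneg_iff_mono_on:
  fixes f :: "real \<Rightarrow> real"
  assumes "continuous_on {a..b} f" "specularly_differentiable_on f {a<..<b}"
  shows "(\<forall>x\<in>{a<..<b}. specular_deriv f x \<ge> 0) \<longleftrightarrow> mono_on {a..b} f"
  using assms specular_deriv_nonneg_imp_mono_on[of a b f]
    mono_on_imp_specular_deriv_nonneg[of a b f]
  unfolding specularly_differentiable_on_def by blast

lemma specular_deriv_nonpos_iff_antimono_on:
  fixes f :: "real \<Rightarrow> real"
  assumes "continuous_on {a..b} f" and diff: "specularly_differentiable_on f {a<..<b}"
  shows "(\<forall>x\<in>{a<..<b}. specular_deriv f x \<le> 0) \<longleftrightarrow> antimono_on {a..b} f"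
proof -
  have "(\<forall>x\<in>{a<..<b}. specular_deriv f x \<le> 0) \<longleftrightarrow>
      (\<forall>x\<in>{a<..<b}. specular_deriv (\<lambda>x. - f x) x \<ge> 0)"
    using diff by (simp add: specular_deriv_uminus specularly_differentiable_on_def)
  also have "\<dots> \<longleftrightarrow> mono_on {a..b} (\<lambda>x. - f x)"
    using assms
    by (intro specular_deriv_nonneg_iff_mono_on continuous_on_minus
        specularly_differentiable_on_uminus)
  also have "\<dots> \<longleftrightarrow> antimono_on {a..b} f"
    by (simp add: monotone_on_def)
  finally show ?thesis .
qed

lemma constant_on_iff_mono_on_antimono_on:
  fixes f :: "'a::linorder \<Rightarrow> 'b::order"
  shows "f constant_on S \<longleftrightarrow> mono_on S f \<and> antimono_on S f"
proof
  assume "mono_on S f \<and> antimono_on S f"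
  then have "f x = f y" if "x \<in> S" "y \<in> S" for x y
    using that linear[of x y] by (auto simp: monotone_on_def intro: antisym)
  then show "f constant_on S"
    unfolding constant_on_def by blast
qed (auto simp: constant_on_def monotone_on_def)

theorem corollary3p5:
  fixes a b :: real and f :: "real \<Rightarrow> real"
  assumes "a < b"
    and "continuous_on {a..b} f"
    and "specularly_differentiable_on f {a<..<b}"
  shows "((\<forall>x\<in>{a<..<b}. specular_deriv f x \<ge> 0) \<longleftrightarrow> mono_on {a..b} f) \<and>
         ((\<forall>x\<in>{a<..<b}. specular_deriv f x \<le> 0) \<longleftrightarrow> antimono_on {a..b} f) \<and>
         ((\<forall>x\<in>{a<..<b}. specular_deriv f x = 0) \<longleftrightarrow> f constant_on {a..b})"
proof -
  note iffs = specular_deriv_nonneg_iff_mono_on[OF assms(2,3)]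
    specular_deriv_nonpos_iff_antimono_on[OF assms(2,3)]
  have "(\<forall>x\<in>{a<..<b}. specular_deriv f x = 0) \<longleftrightarrow>
      (\<forall>x\<in>{a<..<b}. specular_deriv f x \<ge> 0) \<and> (\<forall>x\<in>{a<..<b}. specular_deriv f x \<le> 0)"
    by (auto simp: order_eq_iff)
  with iffs show ?thesis
    by (simp add: constant_on_iff_mono_on_antimono_on)
qed

end
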